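(* For every complex $s$ with $\mathrm{Re}(s)>0$, the series (in $n$) $$1+\sum_{n=1}^{\infty}\frac{(n-s)!}{n!\,(1-s)!}\left[\sum_{j=2}^{\infty}(-1)^{j-1}\frac{n}{j^2}\left(1-\frac1j\right)^{n-1}\right],$$ which is the binomial series expansion of $\eta(s)$, converges absolutely.
   Context: $\eta(s)=\sum_{n=1}^\infty (-1)^{n+1}n^{-s}=(1-2^{1-s})\zeta(s)$ is the Dirichlet eta function. The factorial of a complex number is $x!=\Gamma(x+1)$, and the quotient $\frac{(n-s)!}{(1-s)!}$ means the polynomial $\prod_{j=2}^{n}(j-s)$ (equal to $1$ for $n=1$). *)

theory Defs
  imports "HOL-Analysis.Analysis"
begin

text \<open>
  The eta function is given by its Dirichlet series, which converges (conditionally for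
  \<open>Re s \<le> 1\<close>) on the half-plane \<open>Re s > 0\<close>, see \<open>summable_dirichlet_eta\<close>. Its values for
  \<open>Re s \<le> 0\<close> carry no meaning here.
\<close>
definition dirichlet_eta :: "complex \<Rightarrow> complex" where
  "dirichlet_eta s = (\<Sum>n. (-1) ^ n * of_nat (Suc n) powr (- s))"

text \<open>
  The quotient \<open>(n - s)! / (1 - s)!\<close> is read as the polynomial \<open>(2 - s) \<cdots> (n - s)\<close>, so that
  no poles of the Gamma function are involved.
\<close>
definition fact_quotient :: "complex \<Rightarrow> nat \<Rightarrow> complex" where
  "fact_quotient s n = (\<Prod>j=2..n. of_nat j - s)"

text \<open>
  The index of the series is shifted: the summand for \<open>i\<close> is the one for \<open>j = i + 2\<close>.
  Only \<open>n \<ge> 1\<close> is meaningful.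
\<close>
definition inner_sum :: "nat \<Rightarrow> real" where
  "inner_sum n =
     (\<Sum>i. let j = i + 2 in (-1) ^ (j - 1) * (real n / real j ^ 2) * (1 - 1 / real j) ^ (n - 1))"

definition eta_binomial_term :: "complex \<Rightarrow> nat \<Rightarrow> complex" where
  "eta_binomial_term s n = fact_quotient s n / fact n * of_real (inner_sum n)"

text \<open>The two defining series above do converge, so no default values of \<open>suminf\<close> occur.\<close>

lemma summable_inner_sum:
  "summable (\<lambda>i. let j = i + 2 in
     (-1) ^ (j - 1) * (real n / real j ^ 2) * (1 - 1 / real j) ^ (n - 1))"
proof (rule summable_comparison_test')
  have "summable (\<lambda>i. inverse ((real (i + 2)) ^ 2))"
    using summable_ignore_initial_segment[OF inverse_power_summable[of 2, where 'a = real], of 2] by simp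
  then show "summable (\<lambda>i. real n * inverse ((real (i + 2)) ^ 2))"
    by (rule summable_mult)
next
  fix i :: nat
  have "\<bar>1 - 1 / real (i + 2)\<bar> ^ (n - 1) \<le> 1"
    by (rule power_le_one) (auto simp: field_simps)
  then have "real n / real (i + 2) ^ 2 * \<bar>1 - 1 / real (i + 2)\<bar> ^ (n - 1)
      \<le> real n / real (i + 2) ^ 2 * 1"
    by (rule mult_left_mono) auto
  then show "norm (let j = i + 2 in
       (-1) ^ (j - 1) * (real n / real j ^ 2) * (1 - 1 / real j) ^ (n - 1))
      \<le> real n * inverse ((real (i + 2)) ^ 2)"
    by (simp add: Let_def abs_mult power_abs divide_inverse)
qed

lemma summable_dirichlet_eta:
  fixes s :: complex
  assumes "Re s > 0"
  shows "summable (\<lambda>n. (-1) ^ n * of_nat (Suc n) powr (- s))"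
proof -
  define f where "f = (\<lambda>n. (-1) ^ n * complex_of_nat (Suc n) powr (- s))"
  define d where "d = (\<lambda>k. complex_of_nat (Suc (2*k)) powr (- s) - of_nat (Suc (Suc (2*k))) powr (- s))"
  have norm_f: "norm (f n) = real (Suc n) powr (- Re s)" for n
    by (simp add: f_def norm_mult norm_power norm_powr_real_powr del: of_nat_Suc)
  have "(\<lambda>n. real (Suc n) powr (- Re s)) \<longlonglongrightarrow> 0"
    using assms by (intro tendsto_neg_powr filterlim_compose[OF filterlim_real_sequentially filterlim_Suc]) auto
  then have f0: "f \<longlonglongrightarrow> 0"
    by (subst tendsto_norm_zero_iff[symmetric]) (simp add: norm_f)
  have d_bound: "norm (d k) \<le> norm s * real (Suc k) powr (- Re s - 1)" for k
  proof -
    define a where "a = real (Suc (2*k))"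
    have a: "a \<ge> real (Suc k)" "a \<ge> 1" by (auto simp: a_def)
    have "norm (complex_of_real a powr (- s) - of_real (a + 1) powr (- s))
        \<le> (norm s * real (Suc k) powr (- Re s - 1)) * norm (complex_of_real a - of_real (a + 1))"
    proof (rule field_differentiable_bound[where S = "closed_segment (complex_of_real a) (of_real (a + 1))"
          and f' = "\<lambda>z. (- s) * z powr (- s - 1)"])
      fix z assume z: "z \<in> closed_segment (complex_of_real a) (of_real (a + 1))"
      then obtain x where x: "z = of_real x" "x \<in> closed_segment a (a + 1)"
        by (metis (no_types, lifting) closed_segment_of_real imageE)
      then have xa: "x \<ge> a" by (auto simp: closed_segment_eq_real_ivl)
      have "z \<notin> \<real>\<^sub>\<le>\<^sub>0" using x xa a by auto
      then show "((\<lambda>z. z powr (- s)) has_field_derivative (- s) * z powr (- s - 1))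
           (at z within closed_segment (complex_of_real a) (of_real (a + 1)))"
        by (rule has_field_derivative_at_within[OF has_field_derivative_powr])
      have "norm (z powr (- s - 1)) = x powr (- Re s - 1)"
        using x xa a by (simp add: norm_powr_real_powr)
      also have "\<dots> \<le> real (Suc k) powr (- Re s - 1)"
        using xa a assms by (intro powr_mono2') auto
      finally show "norm ((- s) * z powr (- s - 1)) \<le> norm s * real (Suc k) powr (- Re s - 1)"
        by (simp add: norm_mult mult_left_mono)
    qed auto
    moreover have "norm (complex_of_real a - of_real (a + 1)) = 1"
      by (simp add: norm_minus_commute)
    moreover have "d k = complex_of_real a powr (- s) - of_real (a + 1) powr (- s)"
      by (simp add: d_def a_def add.commute)
    ultimately show ?thesis by simp
  qed
  have "summable (\<lambda>k. real k powr (- Re s - 1))"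
    using assms by (subst summable_real_powr_iff) auto
  then have "summable (\<lambda>k. real (Suc k) powr (- Re s - 1))"
    by (subst summable_Suc_iff)
  then have "summable d"
    by (intro summable_comparison_test'[OF summable_mult[of _ "norm s"] d_bound])
  then obtain L where "(\<lambda>N. \<Sum>k<N. d k) \<longlonglongrightarrow> L"
    by (auto simp: summable_def sums_def)
  moreover have even_sum: "(\<Sum>n<2*N. f n) = (\<Sum>k<N. d k)" for N
    by (induction N) (auto simp: f_def d_def)
  ultimately have ev: "(\<lambda>N. \<Sum>n<2*N. f n) \<longlonglongrightarrow> L" by simp
  have "(\<lambda>N. f (2*N)) \<longlonglongrightarrow> 0"
    using LIMSEQ_subseq_LIMSEQ[OF f0, of "\<lambda>N. 2*N"] by (simp add: o_def strict_mono_def)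
  from tendsto_add[OF ev this] have od: "(\<lambda>N. \<Sum>n<2*N+1. f n) \<longlonglongrightarrow> L" by simp
  have "f sums L"
    unfolding sums_def
  proof (rule metric_LIMSEQ_I)
    fix e :: real assume "e > 0"
    then obtain M M' where M: "\<And>N. N \<ge> M \<Longrightarrow> dist (\<Sum>n<2*N. f n) L < e"
      and M': "\<And>N. N \<ge> M' \<Longrightarrow> dist (\<Sum>n<2*N+1. f n) L < e"
      using metric_LIMSEQ_D[OF ev] metric_LIMSEQ_D[OF od] by meson
    have "dist (sum f {..<m}) L < e" if "m \<ge> 2 * max M M' + 1" for m
    proof (cases "even m")
      case True
      then obtain N where "m = 2 * N" by (elim evenE)
      then show ?thesis using M[of N] that by simp
    next
      case False
      then obtain N where "m = 2 * N + 1" by (elim oddE)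
      then show ?thesis using M'[of N] that by simp
    qed
    then show "\<exists>no. \<forall>m\<ge>no. dist (sum f {..<m}) L < e" by blast
  qed
  then show ?thesis by (simp add: f_def sums_iff)
qed

end

theory Submission
  imports Defs
begin

text \<open>
  Write \<open>j powr (- s) = j\<^sup>-\<^sup>2 (1 - (1 - 1/j)) powr (s - 2)\<close> and expand by the binomial series:
  with \<open>c\<^sub>m = (2 - s)(3 - s)\<cdots>(m + 1 - s) / m!\<close> this gives
  \<open>j powr (- s) = (\<Sum>m. c\<^sub>m \<phi>\<^sub>m (1/j))\<close>, where \<open>\<phi>\<^sub>m t = t\<^sup>2 (1 - t)\<^sup>m\<close>. Taking the alternating sum over
  \<open>j \<ge> 2\<close> and exchanging the two summations yields the series in question, with \<open>n = m + 1\<close>.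

  All the analysis is in the exchange. For \<open>Re s \<le> 1\<close> the double series is not absolutely
  convergent, so the cancellation in \<open>j\<close> has to be used. The function \<open>\<phi>\<^sub>m\<close> increases up to
  \<open>2 / (m + 2)\<close> and then decreases on \<open>[0, 1]\<close>, hence every partial alternating sum of its values at the points \<open>1/j\<close>
  is bounded by a constant times its maximum (\<open>alternating_sum_unimodal_le\<close>), and this maximum is
  \<open>O(m\<^sup>-\<^sup>2)\<close> (\<open>bump_le\<close>). On the other hand \<open>c\<^sub>m = O(m powr (1 - Re s))\<close> by Euler's limit formula for
  \<open>1/\<Gamma>\<close>. So the sums truncated at any \<open>j \<le> J\<close> are dominated, uniformly in \<open>J\<close>, by
  a multiple of \<open>m powr (- 1 - Re s)\<close>, which is summable exactly because \<open>Re s > 0\<close>. Tannery's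
  theorem then gives both the absolute convergence and the value of the sum.
\<close>

section \<open>Alternating sums of unimodal sequences\<close>

text \<open>
  Summation by parts with the bounded partial sums of \<open>(-1)\<^sup>i\<close>: doubling the sum pairs each term with
  both of its neighbours, and only the two end terms are left without a partner.
\<close>
lemma alternating_sum_variation:
  fixes a :: "nat \<Rightarrow> real"
  shows "\<bar>2 * (\<Sum>i<Suc N. (-1) ^ i * a i) - a 0 - (-1) ^ N * a N\<bar> \<le> (\<Sum>i<N. \<bar>a (Suc i) - a i\<bar>)"
proof (induction N)
  case (Suc N)
  have "2 * (\<Sum>i<Suc (Suc N). (-1) ^ i * a i) - a 0 - (-1) ^ Suc N * a (Suc N)
      = (2 * (\<Sum>i<Suc N. (-1) ^ i * a i) - a 0 - (-1) ^ N * a N) - (-1) ^ N * (a (Suc N) - a N)"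
    by (simp add: algebra_simps)
  moreover have "\<bar>(-1) ^ N * (a (Suc N) - a N)\<bar> = \<bar>a (Suc N) - a N\<bar>"
    by (simp add: abs_mult power_abs)
  ultimately show ?case
    using Suc by (smt (verit) sum.lessThan_Suc)
qed simp

text \<open>
  The step from \<open>p\<close> to \<open>Suc p\<close> may go either way. This fits sequences obtained by sampling a
  unimodal function, whose peak usually lies strictly between two sample points.
\<close>
lemma variation_unimodal_le:
  fixes a :: "nat \<Rightarrow> real"
  assumes "\<And>i. 0 \<le> a i" and le: "\<And>i. a i \<le> M"
    and up: "\<And>i. i < p \<Longrightarrow> a i \<le> a (Suc i)" and down: "\<And>i. p < i \<Longrightarrow> a (Suc i) \<le> a i"
  shows "(\<Sum>i<N. \<bar>a (Suc i) - a i\<bar>) + a N \<le> 2 * M"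
proof -
  have rise: "(\<Sum>i<N. \<bar>a (Suc i) - a i\<bar>) \<le> a N" if "N \<le> p" for N
    using that
  proof (induction N)
    case (Suc N)
    then show ?case using up[of N] by simp
  qed (simp add: assms)
  show ?thesis
  proof (induction N)
    case 0
    then show ?case using assms(1)[of 0] le[of 0] by simp
  next
    case (Suc N)
    consider "N < p" | "N = p" | "p < N" by linarith
    then show ?case
    proof cases
      case 1
      then show ?thesis using rise[of "Suc N"] le[of "Suc N"] by linarith
    next
      case 2
      then show ?thesis using rise[of N] le[of N] le[of "Suc N"] by simp
    next
      case 3
      then show ?thesis using Suc down[of N] by simp
    qed
  qed
qed

lemma alternating_sum_unimodal_le:
  fixes a :: "nat \<Rightarrow> real"
  assumes nonneg: "\<And>i. 0 \<le> a i" and le: "\<And>i. a i \<le> M"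
    and up: "\<And>i. i < p \<Longrightarrow> a i \<le> a (Suc i)" and down: "\<And>i. p < i \<Longrightarrow> a (Suc i) \<le> a i"
  shows "\<bar>\<Sum>i<N. (-1) ^ i * a i\<bar> \<le> 2 * M"
proof (cases N)
  case 0
  then show ?thesis using nonneg[of 0] le[of 0] by simp
next
  case (Suc N')
  have "\<bar>(-1) ^ N' * a N'\<bar> = a N'"
    using nonneg by (simp add: abs_mult power_abs)
  then have "\<bar>2 * (\<Sum>i<N. (-1) ^ i * a i)\<bar> \<le> a 0 + 2 * M"
    using alternating_sum_variation[of a N'] variation_unimodal_le[where a = a and M = M and p = p and N = N', OF assms]
      nonneg[of 0] unfolding Suc by linarith
  then show ?thesis using le[of 0] nonneg[of 0] by linarith
qed

section \<open>The functions \<open>t\<^sup>2 (1 - t)\<^sup>m\<close>\<close>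

definition bump :: "nat \<Rightarrow> real \<Rightarrow> real" where
  "bump m t = t ^ 2 * (1 - t) ^ m"

lemma bump_nonneg: "t \<le> 1 \<Longrightarrow> 0 \<le> bump m t"
  by (simp add: bump_def)

text \<open>Each of the \<open>k + 1\<close> terms of \<open>t (\<Sum>i\<le>k. (1 - t)\<^sup>i) = 1 - (1 - t)\<^sup>k\<^sup>+\<^sup>1\<close> is at least the last one.\<close>
lemma mult_power_one_minus_le:
  fixes t :: real
  assumes "0 \<le> t" "t \<le> 1"
  shows "t * (1 - t) ^ k \<le> 1 / (real k + 1)"
proof -
  have "(\<Sum>i<Suc k. (1 - t) ^ k) \<le> (\<Sum>i<Suc k. (1 - t) ^ i)"
    using assms by (intro sum_mono power_decreasing) auto
  then have "t * (\<Sum>i<Suc k. (1 - t) ^ k) \<le> t * (\<Sum>i<Suc k. (1 - t) ^ i)"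
    using assms by (intro mult_left_mono) auto
  also have "\<dots> = 1 - (1 - t) ^ Suc k"
    by (subst one_diff_power_eq) simp
  also have "\<dots> \<le> 1" using assms by simp
  finally show ?thesis by (simp add: field_simps)
qed

lemma bump_le:
  assumes "0 \<le> t" "t \<le> 1"
  shows "bump m t \<le> 4 / (real m + 1) ^ 2"
proof -
  \<comment> \<open>Half of the exponent goes to each of the two factors \<open>t\<close>.\<close>
  define k where "k = m div 2"
  have "bump m t \<le> t ^ 2 * (1 - t) ^ (2 * k)"
    unfolding bump_def using assms by (intro mult_left_mono power_decreasing) (auto simp: k_def)
  also have "\<dots> = (t * (1 - t) ^ k) ^ 2"
    by (simp add: power_mult_distrib power_mult mult.commute flip: power_mult)
  also have "\<dots> \<le> (1 / (real k + 1)) ^ 2"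
    using assms by (intro power_mono mult_power_one_minus_le) auto
  also have "\<dots> \<le> (2 / (real m + 1)) ^ 2"
  proof (intro power_mono)
    have "real (m + 1) \<le> real (2 * (k + 1))" unfolding of_nat_le_iff by (simp add: k_def)
    then have "real m + 1 \<le> 2 * (real k + 1)" by simp
    then show "1 / (real k + 1) \<le> 2 / (real m + 1)" by (simp add: field_simps)
  qed simp
  finally show ?thesis by (simp add: power_divide)
qed

lemma has_real_derivative_bump:
  "(bump (Suc m) has_real_derivative t * (1 - t) ^ m * (2 - (real m + 3) * t)) (at t)"
  unfolding bump_def by (rule derivative_eq_intros refl)+ (simp add: power2_eq_square algebra_simps)

lemma bump_mono:
  assumes "0 \<le> t" "t \<le> u" "(real m + 2) * u \<le> 2" "u \<le> 1"
  shows "bump m t \<le> bump m u"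
proof (cases m)
  case 0
  then show ?thesis using assms by (simp add: bump_def power_mono)
next
  case (Suc k)
  show ?thesis unfolding Suc
  proof (rule DERIV_nonneg_imp_nondecreasing[OF assms(2)])
    fix x assume x: "t \<le> x" "x \<le> u"
    have "(real m + 2) * x \<le> (real m + 2) * u" using x by (intro mult_left_mono) auto
    then have "0 \<le> 2 - (real k + 3) * x" using assms Suc by (simp add: algebra_simps)
    then have "0 \<le> x * (1 - x) ^ k * (2 - (real k + 3) * x)"
      using x assms by (intro mult_nonneg_nonneg) auto
    then show "\<exists>y. (bump (Suc k) has_real_derivative y) (at x) \<and> 0 \<le> y"
      using has_real_derivative_bump by blast
  qed
qed

lemma bump_antimono:
  assumes "0 \<le> t" "t \<le> u" "2 \<le> (real m + 2) * t" "u \<le> 1"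
  shows "bump m u \<le> bump m t"
proof (cases m)
  case 0
  then show ?thesis using assms by (simp add: bump_def)
next
  case (Suc k)
  show ?thesis unfolding Suc
  proof (rule DERIV_nonpos_imp_nonincreasing[OF assms(2)])
    fix x assume x: "t \<le> x" "x \<le> u"
    have "(real m + 2) * t \<le> (real m + 2) * x" using x by (intro mult_left_mono) auto
    then have "2 - (real k + 3) * x \<le> 0" using assms Suc by (simp add: algebra_simps)
    then have "x * (1 - x) ^ k * (2 - (real k + 3) * x) \<le> 0"
      using x assms by (intro mult_nonneg_nonpos mult_nonneg_nonneg) auto
    then show "\<exists>y. (bump (Suc k) has_real_derivative y) (at x) \<and> y \<le> 0"
      using has_real_derivative_bump by blast
  qed
qed

lemma alternating_sum_bump_le:
  "\<bar>\<Sum>i<N. (-1) ^ i * bump m (1 / (real i + 2))\<bar> \<le> 8 / (real m + 1) ^ 2"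
proof -
  \<comment> \<open>The peak is at \<open>t = 2 / (m + 2)\<close>. The step from \<open>i\<close> to \<open>Suc i\<close> does not pass it as long as
    \<open>i + 3 \<le> (m + 2) / 2\<close>, which means \<open>i < p\<close>.\<close>
  define p where "p = (m + 2) div 2 - 2"
  have "\<bar>\<Sum>i<N. (-1) ^ i * bump m (1 / (real i + 2))\<bar> \<le> 2 * (4 / (real m + 1) ^ 2)"
  proof (rule alternating_sum_unimodal_le[where p = p])
    fix i assume "i < p"
    then have "real (2 * (i + 3)) \<le> real (m + 2)" unfolding of_nat_le_iff by (simp add: p_def)
    then have "2 * (real i + 3) \<le> real m + 2" by simp
    then show "bump m (1 / (real i + 2)) \<le> bump m (1 / (real (Suc i) + 2))"
      by (intro bump_antimono) (auto simp: field_simps)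
  next
    fix i assume "p < i"
    then have "real (m + 2) \<le> real (2 * (i + 2))" unfolding of_nat_le_iff by (simp add: p_def)
    then have "real m + 2 \<le> 2 * (real i + 2)" by simp
    then show "bump m (1 / (real (Suc i) + 2)) \<le> bump m (1 / (real i + 2))"
      by (intro bump_mono) (auto simp: field_simps)
  qed (auto intro!: bump_nonneg bump_le)
  then show ?thesis by simp
qed

section \<open>The binomial coefficients\<close>

definition binomial_coeff :: "complex \<Rightarrow> nat \<Rightarrow> complex" where
  "binomial_coeff s m = pochhammer (2 - s) m / fact m"

lemma fact_quotient_Suc: "fact_quotient s (Suc m) = pochhammer (2 - s) m"
  unfolding fact_quotient_def pochhammer_prod
  by (rule prod.reindex_bij_witness[of _ "\<lambda>i. i + 2" "\<lambda>j. j - 2"]) (auto simp: of_nat_diff)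

lemma eta_binomial_term_Suc:
  "eta_binomial_term s (Suc m) = binomial_coeff s m * of_real (inner_sum (Suc m) / real (Suc m))"
  by (simp add: eta_binomial_term_def fact_quotient_Suc binomial_coeff_def)

lemma binomial_series_powr:
  assumes "x \<ge> 1"
  shows "(\<lambda>m. binomial_coeff s m * of_real (bump m (1 / x))) sums (of_real x powr (- s))"
proof -
  define z where "z = complex_of_real (1 / x - 1)"
  have x: "x > 0" using assms by simp
  have "norm z < 1" unfolding z_def norm_of_real using assms by (simp add: field_simps)
  then have "(\<lambda>m. ((s - 2) gchoose m) * z ^ m) sums (1 + z) powr (s - 2)"
    by (rule gen_binomial_complex)
  moreover have "((s - 2) gchoose m) * z ^ m = binomial_coeff s m * of_real ((1 - 1 / x) ^ m)" for m
  proof -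
    have "z = (-1) * of_real (1 - 1 / x)" by (simp add: z_def)
    then have "z ^ m = (-1) ^ m * of_real ((1 - 1 / x) ^ m)"
      by (simp only: power_mult_distrib of_real_power)
    moreover have "(-1) ^ m * (-1) ^ m = (1 :: complex)"
      by (simp flip: power_mult_distrib)
    ultimately show ?thesis
      by (simp add: gbinomial_pochhammer binomial_coeff_def)
  qed
  ultimately have "(\<lambda>m. of_real (1 / x ^ 2) * (binomial_coeff s m * of_real ((1 - 1 / x) ^ m))) sums
      (of_real (1 / x ^ 2) * (1 + z) powr (s - 2))"
    by (intro sums_mult) simp
  moreover have "of_real (1 / x ^ 2) * (1 + z) powr (s - 2) = of_real x powr (- s)"
  proof -
    have "1 + z = exp (- of_real (ln x))"
      using x by (simp add: z_def exp_minus exp_of_real field_simps)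
    moreover have "Ln (exp (- of_real (ln x))) = - of_real (ln x)"
      by (rule Ln_exp) auto
    moreover have "complex_of_real (1 / x ^ 2) = exp (- 2 * of_real (ln x))"
      using x by (simp add: exp_minus exp_double exp_of_real field_simps)
    ultimately show ?thesis
      using x by (simp add: powr_def Ln_of_real algebra_simps flip: exp_add)
  qed
  ultimately show ?thesis
    by (simp add: bump_def power_one_over mult.left_commute)
qed

text \<open>
  The quantities compared in Euler's formula are \<open>pochhammer z (n + 1)\<close> and \<open>n! n powr z\<close>; with
  \<open>z = 2 - s\<close> its convergence bounds the coefficients by a multiple of \<open>n powr (1 - Re s)\<close>.
\<close>
lemma summable_binomial_coeff_majorant:
  assumes "Re s > 0"
  shows "summable (\<lambda>m. norm (binomial_coeff s m) * (8 / (real m + 1) ^ 2))"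
proof -
  have "Bseq (rGamma_series (2 - s))"
    by (rule convergent_imp_Bseq) (auto simp: convergent_def intro: rGamma_series_LIMSEQ)
  then obtain K where K: "\<And>n. norm (rGamma_series (2 - s) n) \<le> K" "K > 0"
    by (meson BseqE)
  have "summable (\<lambda>n. norm (binomial_coeff s (Suc n)) * (8 / (real (Suc n) + 1) ^ 2))"
  proof (rule summable_comparison_test'[where N = 1])
    show "summable (\<lambda>n. 8 * K * real n powr (- 1 - Re s))"
      using assms by (intro summable_mult) (simp add: summable_real_powr_iff)
  next
    fix n :: nat assume n: "n \<ge> 1"
    have coeff: "binomial_coeff s (Suc n)
        = rGamma_series (2 - s) n * exp ((2 - s) * of_real (ln (real n))) / of_nat (Suc n)"
      by (simp add: binomial_coeff_def rGamma_series_def)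
    have "norm (exp ((2 - s) * of_real (ln (real n)))) = real n powr (2 - Re s)"
      using n by (simp add: norm_exp_eq_Re powr_def)
    then have "norm (binomial_coeff s (Suc n)) \<le> K * real n powr (2 - Re s) / real (Suc n)"
      unfolding coeff norm_divide norm_mult norm_of_nat using K n
      by (intro divide_right_mono mult_mono) auto
    also have "\<dots> \<le> K * real n powr (2 - Re s) / real n"
      using n K by (intro divide_left_mono) auto
    finally have "norm (binomial_coeff s (Suc n)) * (8 / (real (Suc n) + 1) ^ 2)
        \<le> (K * real n powr (2 - Re s) / real n) * (8 / real n ^ 2)"
      using n K by (intro mult_mono divide_left_mono power_mono) auto
    also have "\<dots> = 8 * K * (real n powr (2 - Re s) / real n ^ 3)"
      by (simp add: power2_eq_square power3_eq_cube mult_ac)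
    also have "real n powr (2 - Re s) / real n ^ 3 = real n powr (- 1 - Re s)"
      using n powr_diff[of "real n" "2 - Re s" 3] by simp
    finally show "norm (norm (binomial_coeff s (Suc n)) * (8 / (real (Suc n) + 1) ^ 2))
        \<le> 8 * K * real n powr (- 1 - Re s)" by simp
  qed
  then show ?thesis by (subst (asm) summable_Suc_iff)
qed

section \<open>Exchanging the summations\<close>

lemma inner_sum_bump:
  "(\<lambda>i. (-1) ^ Suc i * bump m (1 / (real i + 2))) sums (inner_sum (Suc m) / real (Suc m))"
proof -
  have eq: "(let j = i + 2 in (-1) ^ (j - 1) * (real (Suc m) / real j ^ 2) * (1 - 1 / real j) ^ (Suc m - 1))
      = real (Suc m) * ((-1) ^ Suc i * bump m (1 / (real i + 2)))" for i
    by (simp add: Let_def bump_def power_one_over add.commute)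
  have "(\<lambda>i. real (Suc m) * ((-1) ^ Suc i * bump m (1 / (real i + 2)))) sums inner_sum (Suc m)"
    using summable_sums[OF summable_inner_sum[of "Suc m"]] unfolding inner_sum_def eq .
  from sums_divide[OF this, of "real (Suc m)"] show ?thesis by simp
qed

theorem theorem2p1:
  fixes s :: complex
  assumes "Re s > 0"
  shows "summable (\<lambda>n. norm (eta_binomial_term s (Suc n))) \<and>
         dirichlet_eta s = 1 + (\<Sum>n. eta_binomial_term s (Suc n))"
proof -
  define S where "S m J = (\<Sum>i<J. (-1) ^ Suc i * bump m (1 / (real i + 2)))" for m J
  have S_bound: "\<bar>S m J\<bar> \<le> 8 / (real m + 1) ^ 2" for m J
    using alternating_sum_bump_le[of m J] by (simp add: S_def sum_negf)
  have tannery: "summable (\<lambda>m. norm (eta_binomial_term s (Suc m)))"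
      "(\<lambda>J. \<Sum>m. binomial_coeff s m * of_real (S m J)) \<longlonglongrightarrow> (\<Sum>m. eta_binomial_term s (Suc m))"
  proof -
    have lim: "(\<lambda>J. binomial_coeff s m * of_real (S m J)) \<longlonglongrightarrow> eta_binomial_term s (Suc m)" for m
      using inner_sum_bump[of m] unfolding sums_def eta_binomial_term_Suc S_def
      by (intro tendsto_mult tendsto_of_real tendsto_const)
    have dom: "norm (binomial_coeff s m * of_real (S m J))
        \<le> norm (binomial_coeff s m) * (8 / (real m + 1) ^ 2)" for m J
      unfolding norm_mult norm_of_real using S_bound by (intro mult_left_mono) auto
    have "\<forall>\<^sub>F (m, J) in at_top \<times>\<^sub>F sequentially. norm (binomial_coeff s m * of_real (S m J))
        \<le> norm (binomial_coeff s m) * (8 / (real m + 1) ^ 2)"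
      by (rule always_eventually) (use dom in auto)
    from tannerys_theorem[OF lim this summable_binomial_coeff_majorant[OF assms]]
    show "summable (\<lambda>m. norm (eta_binomial_term s (Suc m)))"
      "(\<lambda>J. \<Sum>m. binomial_coeff s m * of_real (S m J)) \<longlonglongrightarrow> (\<Sum>m. eta_binomial_term s (Suc m))"
      by auto
  qed
  have partial: "(\<Sum>m. binomial_coeff s m * of_real (S m J))
      = (\<Sum>i<J. (-1) ^ Suc i * of_nat (Suc (Suc i)) powr (- s))" for J
  proof -
    have "(\<lambda>m. \<Sum>i<J. (-1) ^ Suc i * (binomial_coeff s m * of_real (bump m (1 / (real i + 2))))) sums
        (\<Sum>i<J. (-1) ^ Suc i * of_real (real i + 2) powr (- s))"
      by (intro sums_sum sums_mult binomial_series_powr) simp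
    then show ?thesis
      by (simp add: sums_iff S_def sum_distrib_left mult_ac add_ac)
  qed
  have "(\<lambda>J. \<Sum>k<Suc J. (-1) ^ k * of_nat (Suc k) powr (- s)) \<longlonglongrightarrow> dirichlet_eta s"
    unfolding dirichlet_eta_def by (intro LIMSEQ_Suc summable_LIMSEQ summable_dirichlet_eta assms)
  moreover have "(\<Sum>k<Suc J. (-1) ^ k * of_nat (Suc k) powr (- s))
      = 1 + (\<Sum>m. binomial_coeff s m * of_real (S m J))" for J
    unfolding partial by (subst sum.lessThan_Suc_shift) simp
  ultimately have "(\<lambda>J. 1 + (\<Sum>m. binomial_coeff s m * of_real (S m J))) \<longlonglongrightarrow> dirichlet_eta s"
    by simp
  from LIMSEQ_unique[OF this tendsto_add[OF tendsto_const tannery(2)]] tannery(1)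
  show ?thesis by simp
qed

end
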